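(* Let $(X,d_X)$ and $(Y,d_Y)$ be metric spaces, with $X$ rectifiably connected, and let $w$ be a weight on $X$. Let $p\in[1,\infty)$, let $A\subseteq Y$ be non-empty, let $K$ be a constant, and assume that $f:X\to Y$ is $p$-regular with respect to the weight $w$, with the set $A$ and the constant $K$. Let $\alpha\in(0,\infty)$, put $\beta=\frac{\alpha}{p}$, and assume that there exists a constant $M_\beta$ such that $$d_{w^{\beta-1}}(x,y)\le M_\beta\, d_X(x,y)^\beta,\quad x,y\in X.$$ If the function $g:X\to\mathbb{R}$, $g(z)=d_Y(f(z),A)^p$, belongs to the local Lipschitz class $\Lambda^\alpha_w(X,\mathbb{R})$, then $f$ belongs to the class $\Lambda^{\frac{\alpha}{p}}(X,Y)$. Moreover, $$\|f\|_{\Lambda^{\frac{\alpha}{p}}(X,Y)}\le M_{\frac{\alpha}{p}}\,K\,\|g\|_{\Lambda^\alpha_w(X,\mathbb{R})}^{\frac1p}.$$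
   Context: A curve in a metric space $(X,d_X)$ is a continuous map $\gamma:[a,b]\to X$; it connects $\gamma(a)$ and $\gamma(b)$. Its length is $\ell(\gamma)=\sup\sum_{i=1}^n d_X(\gamma(t_{i-1}),\gamma(t_i))$ over all finite partitions $a=t_0<\dots<t_n=b$; it is rectifiable if $\ell(\gamma)<\infty$. $\Gamma(x,y)$ is the family of rectifiable curves in $X$ connecting $x$ and $y$; $X$ is rectifiably connected if $\Gamma(x,y)\neq\emptyset$ for all $x,y\in X$. For continuous $u$ on $X$ and a rectifiable curve $\gamma$ of length $\ell$, $\int_\gamma u=\int_0^\ell u(\gamma(s))\,ds$ with $\gamma$ parametrized by arc length. A weight on $X$ is an everywhere positive continuous function on $X$. For a weight $v$ on a rectifiably connected $X$, the weighted distance is $d_v(x,y)=\inf_{\gamma\in\Gamma(x,y)}\int_\gamma v$. $B(x,r)$ is the open ball in $X$ with centre $x$ and radius $r$. $d_Y(y,A)=\inf_{a\in A}d_Y(y,a)$. For $f:X\to Y$ put $d^\ast f(x)=\limsup_{y\to x}\frac{d_Y(f(x),f(y))}{d_X(x,y)}$ if $x$ is not isolated, and $d^\ast f(x)=0$ if $x$ is isolated. $\mathrm{D}^\ast(X,Y)$ is the class of $f:X\to Y$ with $d^\ast f(x)<\infty$ for every $x\in X$. A mapping $f\in\mathrm{D}^\ast(X,Y)$ that is bounded on every open ball $B(x,r)$, $x\in X$, $0<r<w(x)$, is $p$-regular with respect to $w$, with non-empty set $A\subseteq Y$ and constant $K$, if $$d^\ast f(x)\le\frac{K}{r}\sup_{y\in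 B(x,r)}\left|d_Y(f(x),A)^p-d_Y(f(y),A)^p\right|^{\frac1p},\quad x\in X,\ 0<r<w(x).$$ For $\alpha\in(0,\infty)$: $\Lambda^\alpha(X,Y)$ is the class of $f:X\to Y$ for which there is a constant $C$ with $d_Y(f(x),f(y))\le C\,d_X(x,y)^\alpha$ for all $x,y\in X$, and $\|f\|_{\Lambda^\alpha(X,Y)}$ is the infimum of such $C$. The local class $\Lambda^\alpha_w(X,Y)$ is the class of $f:X\to Y$ for which there is a constant $C$ with $d_Y(f(x),f(y))\le C\,d_X(x,y)^\alpha$ for all $x\in X$ and $y\in B(x,w(x))$, and $\|f\|_{\Lambda^\alpha_w(X,Y)}$ is the infimum of such $C$. The real line carries its usual metric. *)

theory Defs
  imports "HOL-Analysis.Analysis"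
begin

text \<open>
  A curve is a triple \<open>(a, b, \<gamma>)\<close>; only the values of \<open>\<gamma>\<close> on \<open>{a..b}\<close> matter.
  The degenerate case \<open>a = b\<close> is allowed (such a curve has length \<open>0\<close>).
\<close>

definition partitions :: "real \<Rightarrow> real \<Rightarrow> (nat \<times> (nat \<Rightarrow> real)) set" where
  "partitions a b = {(n, t). t 0 = a \<and> t n = b \<and> (\<forall>i\<in>{1..n}. t (i - 1) < t i)}"

definition curve_length :: "real \<Rightarrow> real \<Rightarrow> (real \<Rightarrow> 'a::metric_space) \<Rightarrow> ereal" where
  "curve_length a b \<gamma> =
     (SUP (n, t)\<in>partitions a b. ereal (\<Sum>i=1..n. dist (\<gamma> (t (i - 1))) (\<gamma> (t i))))"

definition rectifiable_curves ::
    "'a::metric_space \<Rightarrow> 'a \<Rightarrow> (real \<times> real \<times> (real \<Rightarrow> 'a)) set" where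
  "rectifiable_curves x y =
     {(a, b, \<gamma>). a \<le> b \<and> continuous_on {a..b} \<gamma> \<and> \<gamma> a = x \<and> \<gamma> b = y \<and>
                 curve_length a b \<gamma> < \<infinity>}"

text \<open>
  The arc length parametrization sends \<open>s\<close> to \<open>\<gamma> t\<close>, where \<open>t\<close> is any parameter at which the
  initial piece of the curve has length \<open>s\<close>. The choice of \<open>t\<close> is immaterial, see the lemma
  \<open>arclength_param_curve_length\<close> below.
\<close>

definition arclength_param ::
    "real \<Rightarrow> real \<Rightarrow> (real \<Rightarrow> 'a::metric_space) \<Rightarrow> real \<Rightarrow> 'a" where
  "arclength_param a b \<gamma> s = \<gamma> (SOME t. t \<in> {a..b} \<and> curve_length a t \<gamma> = ereal s)"

definition curve_integral ::
    "real \<Rightarrow> real \<Rightarrow> (real \<Rightarrow> 'a::metric_space) \<Rightarrow> ('a \<Rightarrow> real) \<Rightarrow> real" where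
  "curve_integral a b \<gamma> u =
     integral {0..real_of_ereal (curve_length a b \<gamma>)} (\<lambda>s. u (arclength_param a b \<gamma> s))"

lemma curve_length_add_dist_le:
  assumes "a \<le> s" "s < t"
  shows "curve_length a s \<gamma> + ereal (dist (\<gamma> s) (\<gamma> t)) \<le> curve_length a t \<gamma>"
proof -
  have "curve_length a s \<gamma> \<le> curve_length a t \<gamma> - ereal (dist (\<gamma> s) (\<gamma> t))"
    unfolding curve_length_def [of a s]
  proof (rule SUP_least, clarify)
    fix n :: nat and p :: "nat \<Rightarrow> real"
    assume p: "(n, p) \<in> partitions a s"
    define q where "q = p(Suc n := t)"
    have q: "(Suc n, q) \<in> partitions a t"
      using p assms by (auto simp: partitions_def q_def)
    have "(\<Sum>i=1..Suc n. dist (\<gamma> (q (i - 1))) (\<gamma> (q i)))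
        = (\<Sum>i=1..n. dist (\<gamma> (q (i - 1))) (\<gamma> (q i))) + dist (\<gamma> s) (\<gamma> t)"
      using p by (simp add: q_def partitions_def)
    also have "(\<Sum>i=1..n. dist (\<gamma> (q (i - 1))) (\<gamma> (q i)))
        = (\<Sum>i=1..n. dist (\<gamma> (p (i - 1))) (\<gamma> (p i)))"
      by (intro sum.cong refl) (auto simp: q_def)
    finally have eq: "(\<Sum>i=1..Suc n. dist (\<gamma> (q (i - 1))) (\<gamma> (q i)))
        = (\<Sum>i=1..n. dist (\<gamma> (p (i - 1))) (\<gamma> (p i))) + dist (\<gamma> s) (\<gamma> t)" .
    have "ereal (\<Sum>i=1..Suc n. dist (\<gamma> (q (i - 1))) (\<gamma> (q i))) \<le> curve_length a t \<gamma>"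
      unfolding curve_length_def using SUP_upper [OF q, of "\<lambda>(n, t). ereal (\<Sum>i=1..n. dist (\<gamma> (t (i - 1))) (\<gamma> (t i)))"]
      by (simp only: prod.case)
    then show "ereal (\<Sum>i=1..n. dist (\<gamma> (p (i - 1))) (\<gamma> (p i)))
        \<le> curve_length a t \<gamma> - ereal (dist (\<gamma> s) (\<gamma> t))"
      unfolding eq by (cases "curve_length a t \<gamma>") auto
  qed
  then show ?thesis
    by (cases "curve_length a t \<gamma>"; cases "curve_length a s \<gamma>") auto
qed

lemma arclength_param_curve_length:
  assumes "t \<in> {a..b}" "curve_length a t \<gamma> = ereal s"
  shows "arclength_param a b \<gamma> s = \<gamma> t"
proof -
  define t' where "t' = (SOME t. t \<in> {a..b} \<and> curve_length a t \<gamma> = ereal s)"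
  have t': "t' \<in> {a..b}" "curve_length a t' \<gamma> = ereal s"
    using someI [of "\<lambda>t. t \<in> {a..b} \<and> curve_length a t \<gamma> = ereal s" t] assms
    unfolding t'_def by auto
  have "\<gamma> t' = \<gamma> t"
    using curve_length_add_dist_le [of a t t' \<gamma>] curve_length_add_dist_le [of a t' t \<gamma>] assms t'
    by (cases t t' rule: linorder_cases) auto
  then show ?thesis
    by (simp add: arclength_param_def t'_def)
qed

definition rectifiably_connected :: "'a::metric_space itself \<Rightarrow> bool" where
  "rectifiably_connected _ \<longleftrightarrow> (\<forall>x y :: 'a. rectifiable_curves x y \<noteq> {})"

definition weight :: "('a::metric_space \<Rightarrow> real) \<Rightarrow> bool" where
  "weight v \<longleftrightarrow> continuous_on UNIV v \<and> (\<forall>x. 0 < v x)"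

text \<open>
  The infimum is a real one; it is the intended one when the space is rectifiably connected and
  \<open>v\<close> is a weight (the set is then non-empty and bounded below by \<open>0\<close>).
\<close>

definition weighted_dist :: "('a::metric_space \<Rightarrow> real) \<Rightarrow> 'a \<Rightarrow> 'a \<Rightarrow> real" where
  "weighted_dist v x y = (INF (a, b, \<gamma>)\<in>rectifiable_curves x y. curve_integral a b \<gamma> v)"

definition dstar :: "('a::metric_space \<Rightarrow> 'b::metric_space) \<Rightarrow> 'a \<Rightarrow> ereal" where
  "dstar f x =
     (if x islimpt UNIV then Limsup (at x) (\<lambda>y. ereal (dist (f x) (f y) / dist x y)) else 0)"

definition Dstar :: "('a::metric_space \<Rightarrow> 'b::metric_space) set" where
  "Dstar = {f. \<forall>x. dstar f x < \<infinity>}"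

definition p_regular ::
    "real \<Rightarrow> ('a::metric_space \<Rightarrow> real) \<Rightarrow> 'b set \<Rightarrow> real \<Rightarrow> ('a \<Rightarrow> 'b::metric_space) \<Rightarrow> bool" where
  "p_regular p w A K f \<longleftrightarrow>
     f \<in> Dstar \<and>
     (\<forall>x r. 0 < r \<and> r < w x \<longrightarrow> bounded (f ` ball x r)) \<and>
     A \<noteq> {} \<and>
     (\<forall>x r. 0 < r \<and> r < w x \<longrightarrow>
        dstar f x \<le> ereal (K / r) *
          (SUP y\<in>ball x r.
             ereal (\<bar>infdist (f x) A powr p - infdist (f y) A powr p\<bar> powr (1 / p))))"

text \<open>
  The constants in the Hoelder classes are taken non-negative. This matters only when the
  space has just one point, where every real constant would be admissible.
\<close>

definition holder_consts ::
    "real \<Rightarrow> ('a::metric_space \<Rightarrow> 'b::metric_space) \<Rightarrow> real set" where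
  "holder_consts \<alpha> f = {C. 0 \<le> C \<and> (\<forall>x y. dist (f x) (f y) \<le> C * dist x y powr \<alpha>)}"

definition holder_class :: "real \<Rightarrow> ('a::metric_space \<Rightarrow> 'b::metric_space) set" where
  "holder_class \<alpha> = {f. holder_consts \<alpha> f \<noteq> {}}"

definition holder_norm :: "real \<Rightarrow> ('a::metric_space \<Rightarrow> 'b::metric_space) \<Rightarrow> real" where
  "holder_norm \<alpha> f = Inf (holder_consts \<alpha> f)"

definition local_holder_consts ::
    "real \<Rightarrow> ('a::metric_space \<Rightarrow> real) \<Rightarrow> ('a \<Rightarrow> 'b::metric_space) \<Rightarrow> real set" where
  "local_holder_consts \<alpha> w f =
     {C. 0 \<le> C \<and> (\<forall>x. \<forall>y\<in>ball x (w x). dist (f x) (f y) \<le> C * dist x y powr \<alpha>)}"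

definition local_holder_class ::
    "real \<Rightarrow> ('a::metric_space \<Rightarrow> real) \<Rightarrow> ('a \<Rightarrow> 'b::metric_space) set" where
  "local_holder_class \<alpha> w = {f. local_holder_consts \<alpha> w f \<noteq> {}}"

definition local_holder_norm ::
    "real \<Rightarrow> ('a::metric_space \<Rightarrow> real) \<Rightarrow> ('a \<Rightarrow> 'b::metric_space) \<Rightarrow> real" where
  "local_holder_norm \<alpha> w f = Inf (local_holder_consts \<alpha> w f)"

end

theory Submission
  imports Defs
begin

text \<open>
  Letting \<open>r\<close> tend to \<open>w x\<close> in the regularity condition and using the local Hoelder bound for \<open>g\<close>
  gives \<open>d\<^sup>* f x \<le> L * w x powr (\<beta> - 1)\<close> with \<open>L = K * \<parallel>g\<parallel> powr (1 / p)\<close>. Along a rectifiable curve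
  parametrized by arc length this pointwise bound integrates, by a compactness argument on the
  parameter interval, to \<open>dist (f x) (f y) \<le> L * \<integral>\<^sub>\<gamma> w powr (\<beta> - 1)\<close>; now take the infimum over \<open>\<gamma>\<close>.
\<close>

section \<open>Length of curves\<close>

abbreviation variation_sum :: "(real \<Rightarrow> 'a::metric_space) \<Rightarrow> nat \<Rightarrow> (nat \<Rightarrow> real) \<Rightarrow> real" where
  "variation_sum \<gamma> n p \<equiv> (\<Sum>i=1..n. dist (\<gamma> (p (i - 1))) (\<gamma> (p i)))"

lemma partitions_0_iff: "(0, p) \<in> partitions a b \<longleftrightarrow> p 0 = a \<and> a = b"
  by (auto simp: partitions_def)

text \<open>Splitting off the last point leaves a partition given by the same function
  \<open>p\<close>, so inductions on the number of subintervals need no reindexing.\<close>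

lemma partitions_Suc_iff:
  "(Suc n, p) \<in> partitions a b \<longleftrightarrow> (n, p) \<in> partitions a (p n) \<and> p n < b \<and> p (Suc n) = b"
  by (auto simp: partitions_def atLeastAtMostSuc_conv)

lemma partitions_le: "(n, p) \<in> partitions a b \<Longrightarrow> a \<le> b"
  by (induction n arbitrary: b) (force simp: partitions_0_iff partitions_Suc_iff)+

lemma partitions_SucD:
  assumes "(Suc n, p) \<in> partitions a b"
  shows "(n, p) \<in> partitions a (p n)" "p n < b" "a \<le> p n" "p (Suc n) = b"
proof -
  show "(n, p) \<in> partitions a (p n)" "p n < b" "p (Suc n) = b"
    using assms by (auto simp: partitions_Suc_iff)
  then show "a \<le> p n" using partitions_le by blast
qed

lemma variation_sum_le_curve_length:
  "(n, p) \<in> partitions a b \<Longrightarrow> ereal (variation_sum \<gamma> n p) \<le> curve_length a b \<gamma>"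
  unfolding curve_length_def by (rule SUP_upper2) auto

lemma curve_length_leI:
  assumes "\<And>n p. (n, p) \<in> partitions a b \<Longrightarrow> ereal (variation_sum \<gamma> n p) \<le> c"
  shows "curve_length a b \<gamma> \<le> c"
  unfolding curve_length_def by (rule SUP_least) (use assms in auto)

lemma curve_length_refl [simp]: "curve_length a a \<gamma> = 0"
proof (rule antisym)
  show "curve_length a a \<gamma> \<le> 0"
  proof (rule curve_length_leI)
    fix n p assume "(n, p) \<in> partitions a a"
    then show "ereal (variation_sum \<gamma> n p) \<le> 0"
      using partitions_SucD by (cases n) (auto, fastforce)
  qed
  have "(0, \<lambda>_. a) \<in> partitions a a" by (simp add: partitions_def)
  then show "0 \<le> curve_length a a \<gamma>"
    using variation_sum_le_curve_length [of 0 "\<lambda>_. a" a a \<gamma>] by (simp add: zero_ereal_def)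
qed

lemma dist_le_curve_length: "a \<le> b \<Longrightarrow> ereal (dist (\<gamma> a) (\<gamma> b)) \<le> curve_length a b \<gamma>"
  using curve_length_add_dist_le [of a a b \<gamma>] by (cases "a = b") (auto simp: zero_ereal_def)

text \<open>The order of the endpoints matters: for \<open>a > b\<close> there are no partitions,
  and the supremum of the empty set in \<open>ereal\<close> is -\<infinity>.\<close>

lemma curve_length_nonneg: "a \<le> b \<Longrightarrow> 0 \<le> curve_length a b \<gamma>"
  using dist_le_curve_length [of a b \<gamma>] by (meson order_trans ereal_less_eq(5) zero_le_dist)

lemma curve_length_add_dist_le':
  "a \<le> s \<Longrightarrow> s \<le> t \<Longrightarrow> curve_length a s \<gamma> + ereal (dist (\<gamma> s) (\<gamma> t)) \<le> curve_length a t \<gamma>"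
  using curve_length_add_dist_le [of a s t \<gamma>] by (cases "s = t") (auto simp flip: zero_ereal_def)

text \<open>The superadditive half of \<open>curve_length_add\<close>. Starting from the length up
  to \<open>t\<close>, the induction appends the chords of a partition of the remaining interval one
  at a time.\<close>

lemma curve_length_add_variation_sum_le:
  assumes "a \<le> t"
  shows "(n, p) \<in> partitions t b \<Longrightarrow>
    curve_length a t \<gamma> + ereal (variation_sum \<gamma> n p) \<le> curve_length a b \<gamma>"
proof (induction n arbitrary: b)
  case 0
  then show ?case by (auto simp: partitions_0_iff simp flip: zero_ereal_def)
next
  case (Suc n)
  note p = partitions_SucD [OF Suc.prems]
  have "curve_length a t \<gamma> + ereal (variation_sum \<gamma> (Suc n) p)
      = (curve_length a t \<gamma> + ereal (variation_sum \<gamma> n p)) + ereal (dist (\<gamma> (p n)) (\<gamma> b))"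
    using p(4) by (simp add: add.assoc)
  also have "\<dots> \<le> curve_length a (p n) \<gamma> + ereal (dist (\<gamma> (p n)) (\<gamma> b))"
    by (intro add_mono Suc.IH p order_refl)
  also have "\<dots> \<le> curve_length a b \<gamma>"
    using assms p by (intro curve_length_add_dist_le') auto
  finally show ?case .
qed

text \<open>The subadditive half of \<open>curve_length_add\<close>. If \<open>t\<close> lies before
  the last subinterval, the induction hypothesis applies; otherwise the triangle inequality splits
  the last chord at \<open>t\<close>.\<close>

lemma variation_sum_le_add_curve_length:
  shows "(n, p) \<in> partitions a b \<Longrightarrow> a \<le> t \<Longrightarrow> t \<le> b \<Longrightarrow>
    ereal (variation_sum \<gamma> n p) \<le> curve_length a t \<gamma> + curve_length t b \<gamma>"
proof (induction n arbitrary: b)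
  case 0
  then show ?case by (auto simp: partitions_0_iff simp flip: zero_ereal_def)
next
  case (Suc n)
  note p = partitions_SucD [OF Suc.prems(1)]
  have sum: "ereal (variation_sum \<gamma> (Suc n) p)
      = ereal (variation_sum \<gamma> n p) + ereal (dist (\<gamma> (p n)) (\<gamma> b))"
    using p(4) by simp
  show ?case
  proof (cases "t \<le> p n")
    case True
    have "ereal (variation_sum \<gamma> (Suc n) p)
        \<le> curve_length a t \<gamma> + (curve_length t (p n) \<gamma> + ereal (dist (\<gamma> (p n)) (\<gamma> b)))"
      unfolding sum add.assoc [symmetric] using True Suc.prems p by (intro add_mono Suc.IH) auto
    also have "\<dots> \<le> curve_length a t \<gamma> + curve_length t b \<gamma>"
      using True p by (intro add_mono order_refl curve_length_add_dist_le') auto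
    finally show ?thesis .
  next
    case False
    have "ereal (variation_sum \<gamma> (Suc n) p)
        \<le> curve_length a (p n) \<gamma> + (ereal (dist (\<gamma> (p n)) (\<gamma> t)) + ereal (dist (\<gamma> t) (\<gamma> b)))"
      unfolding sum using variation_sum_le_curve_length [OF p(1), of \<gamma>] dist_triangle
      by (intro add_mono) auto
    also have "\<dots> \<le> curve_length a t \<gamma> + curve_length t b \<gamma>"
      unfolding add.assoc [symmetric] using False Suc.prems p
      by (intro add_mono dist_le_curve_length curve_length_add_dist_le') auto
    finally show ?thesis .
  qed
qed

lemma curve_length_add:
  assumes "a \<le> t" "t \<le> b"
  shows "curve_length a b \<gamma> = curve_length a t \<gamma> + curve_length t b \<gamma>"
proof (rule antisym)
  show "curve_length a b \<gamma> \<le> curve_length a t \<gamma> + curve_length t b \<gamma>"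
    using assms by (intro curve_length_leI variation_sum_le_add_curve_length)
  show "curve_length a t \<gamma> + curve_length t b \<gamma> \<le> curve_length a b \<gamma>"
  \<comment> \<open>Only a finite length can be moved to the other side in \<open>ereal\<close>. If
    the initial length is infinite, monotonicity in the right endpoint makes the total infinite
    too.\<close>
  proof (cases "curve_length a t \<gamma>")
    case (real r)
    have "curve_length t b \<gamma> \<le> curve_length a b \<gamma> - ereal r"
    proof (rule curve_length_leI)
      fix n p assume "(n, p) \<in> partitions t b"
      from curve_length_add_variation_sum_le [OF assms(1) this, of \<gamma>] real
      show "ereal (variation_sum \<gamma> n p) \<le> curve_length a b \<gamma> - ereal r"
        by (cases "curve_length a b \<gamma>") (auto simp: algebra_simps)
    qed
    then show ?thesis using real
      by (cases "curve_length a b \<gamma>"; cases "curve_length t b \<gamma>") auto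
  next
    case PInf
    then show ?thesis
      using curve_length_add_dist_le' [OF assms, of \<gamma>] by simp
  next
    case MInf
    then show ?thesis using curve_length_nonneg [OF assms(1), of \<gamma>] by simp
  qed
qed

text \<open>A point \<open>t\<close> of the first subinterval splits the first chord, and only the
  part after \<open>t\<close> is enlarged to a length. Keeping the chord from \<open>a\<close> to
  \<open>t\<close> is what later yields right continuity of arc length.\<close>

lemma variation_sum_le_dist_add_curve_length:
  shows "(Suc n, p) \<in> partitions a b \<Longrightarrow> a \<le> t \<Longrightarrow> t \<le> p 1 \<Longrightarrow>
    ereal (variation_sum \<gamma> (Suc n) p) \<le> ereal (dist (\<gamma> a) (\<gamma> t)) + curve_length t b \<gamma>"
proof (induction n arbitrary: b)
  case 0
  then have "p 0 = a" "p 1 = b" by (auto simp: partitions_def)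
  then have "ereal (variation_sum \<gamma> (Suc 0) p) \<le> ereal (dist (\<gamma> a) (\<gamma> t)) + ereal (dist (\<gamma> t) (\<gamma> b))"
    by (simp add: dist_triangle)
  also have "\<dots> \<le> ereal (dist (\<gamma> a) (\<gamma> t)) + curve_length t b \<gamma>"
    using 0 \<open>p 1 = b\<close> by (intro add_mono order_refl dist_le_curve_length) auto
  finally show ?case .
next
  case (Suc n)
  note p = partitions_SucD [OF Suc.prems(1)]
  \<comment> \<open>The shifted tail is a partition starting at \<open>p 1\<close>, which gives
    \<open>p 1 \<le> p (Suc n)\<close>.\<close>
  have "(n, \<lambda>i. p (Suc i)) \<in> partitions (p 1) (p (Suc n))"
    using p(1) by (auto simp: partitions_def dest: bspec [where x = "Suc i" for i])
  then have "t \<le> p (Suc n)" using partitions_le Suc.prems by fastforce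
  have "ereal (variation_sum \<gamma> (Suc (Suc n)) p)
      = ereal (variation_sum \<gamma> (Suc n) p) + ereal (dist (\<gamma> (p (Suc n))) (\<gamma> b))"
    using p(4) by simp
  also have "\<dots> \<le> ereal (dist (\<gamma> a) (\<gamma> t)) +
      (curve_length t (p (Suc n)) \<gamma> + ereal (dist (\<gamma> (p (Suc n))) (\<gamma> b)))"
    unfolding add.assoc [symmetric] using Suc.prems p by (intro add_mono Suc.IH) auto
  also have "\<dots> \<le> ereal (dist (\<gamma> a) (\<gamma> t)) + curve_length t b \<gamma>"
    using p \<open>t \<le> p (Suc n)\<close> by (intro add_mono order_refl curve_length_add_dist_le') auto
  finally show ?case .
qed

lemma partition_almost_curve_length:
  assumes "curve_length a b \<gamma> < \<infinity>" "a < b" "0 < e"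
  obtains n p where "(Suc n, p) \<in> partitions a b"
    "curve_length a b \<gamma> < ereal (variation_sum \<gamma> (Suc n) p) + ereal e"
proof -
  obtain l where l: "curve_length a b \<gamma> = ereal l"
    using assms curve_length_nonneg [of a b \<gamma>] by (cases "curve_length a b \<gamma>") auto
  have "ereal (l - e) < curve_length a b \<gamma>" using l assms by simp
  then obtain n p where p: "(n, p) \<in> partitions a b" "l - e < variation_sum \<gamma> n p"
    unfolding curve_length_def less_SUP_iff by auto
  moreover obtain m where "n = Suc m"
    using p assms by (cases n) (auto simp: partitions_def)
  ultimately show ?thesis using that [of m p] l by auto
qed

section \<open>Arc length parametrization\<close>

context
  fixes a b :: real and \<gamma> :: "real \<Rightarrow> 'a::metric_space"
  assumes ab: "a \<le> b" and cont: "continuous_on {a..b} \<gamma>" and rect: "curve_length a b \<gamma> < \<infinity>"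
begin

text \<open>By additivity the length of a piece is one of three non-negative summands of a finite
  total.\<close>

lemma curve_length_sub_finite:
  assumes "a \<le> s" "s \<le> t" "t \<le> b"
  shows "curve_length s t \<gamma> = ereal (real_of_ereal (curve_length s t \<gamma>))"
proof -
  have "curve_length a b \<gamma> = curve_length a s \<gamma> + (curve_length s t \<gamma> + curve_length t b \<gamma>)"
    using assms curve_length_add [of a s b \<gamma>] curve_length_add [of s t b \<gamma>] by simp
  then have "\<bar>curve_length s t \<gamma>\<bar> \<noteq> \<infinity>"
    using assms rect curve_length_nonneg [of s t \<gamma>] by auto
  then show ?thesis by (simp add: ereal_real')
qed

private definition len :: "real \<Rightarrow> real" where "len t = real_of_ereal (curve_length a t \<gamma>)"

lemma curve_length_len: "t \<in> {a..b} \<Longrightarrow> curve_length a t \<gamma> = ereal (len t)"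
  unfolding len_def using curve_length_sub_finite [of a t] by simp

lemma len_diff:
  assumes "a \<le> s" "s \<le> t" "t \<le> b"
  shows "curve_length s t \<gamma> = ereal (len t - len s)"
  using curve_length_add [of a s t \<gamma>] curve_length_len [of s] curve_length_len [of t]
    curve_length_sub_finite [OF assms] assms
  by (cases "curve_length s t \<gamma>") auto

lemma len_mono: "a \<le> s \<Longrightarrow> s \<le> t \<Longrightarrow> t \<le> b \<Longrightarrow> len s \<le> len t"
  using len_diff [of s t] curve_length_nonneg [of s t \<gamma>] by simp

lemma dist_le_len_diff: "a \<le> s \<Longrightarrow> s \<le> t \<Longrightarrow> t \<le> b \<Longrightarrow> dist (\<gamma> s) (\<gamma> t) \<le> len t - len s"
  using len_diff [of s t] dist_le_curve_length [of s t \<gamma>] by simp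

text \<open>Take a partition of \<open>{t0..b}\<close> whose sum is within \<open>e\<close> of the
  length. For \<open>t\<close> before its first interior or final point \<open>p 1\<close>, the sum
  is at most the chord from \<open>t0\<close> to \<open>t\<close> plus the length from
  \<open>t\<close> on; subtracting that length gives the claim.\<close>

lemma len_right_close:
  assumes "t0 \<in> {a..b}" "0 < e"
  shows "\<exists>d>0. \<forall>t\<in>{a..b}. t0 \<le> t \<and> t < t0 + d \<longrightarrow> len t - len t0 \<le> dist (\<gamma> t0) (\<gamma> t) + e"
proof (cases "t0 = b")
  case True
  then show ?thesis using assms by (intro exI [of _ 1]) auto
next
  case False
  then obtain n p where p: "(Suc n, p) \<in> partitions t0 b"
      "curve_length t0 b \<gamma> < ereal (variation_sum \<gamma> (Suc n) p) + ereal e"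
    using partition_almost_curve_length [of t0 b \<gamma> e] len_diff [of t0 b] assms by auto
  have "t0 < p 1" using p by (force simp: partitions_def)
  moreover have "len t - len t0 \<le> dist (\<gamma> t0) (\<gamma> t) + e"
    if "t \<in> {a..b}" "t0 \<le> t" "t < p 1" for t
    using variation_sum_le_dist_add_curve_length [OF p(1) that(2), of \<gamma>] that p(2)
      len_diff [of t0 b] len_diff [of t b] assms by auto
  ultimately show ?thesis by (intro exI [of _ "p 1 - t0"]) auto
qed

text \<open>The mirror image, with \<open>t\<close> beyond the last point \<open>p n\<close> before
  \<open>t0\<close> in a nearly optimal partition of \<open>{a..t0}\<close>. The final chord is
  split at \<open>t\<close>, and \<open>len t\<close> bounds everything up to
  \<open>t\<close>.\<close>

lemma len_left_close:
  assumes "t0 \<in> {a..b}" "0 < e"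
  shows "\<exists>d>0. \<forall>t\<in>{a..b}. t \<le> t0 \<and> t0 < t + d \<longrightarrow> len t0 - len t \<le> dist (\<gamma> t0) (\<gamma> t) + e"
proof (cases "t0 = a")
  case True
  then show ?thesis using assms by (intro exI [of _ 1]) auto
next
  case False
  then obtain n p where p: "(Suc n, p) \<in> partitions a t0"
      "curve_length a t0 \<gamma> < ereal (variation_sum \<gamma> (Suc n) p) + ereal e"
    using partition_almost_curve_length [of a t0 \<gamma> e] curve_length_len [of t0] assms by auto
  note q = partitions_SucD [OF p(1)]
  have "len t0 - len t \<le> dist (\<gamma> t0) (\<gamma> t) + e"
    if t: "t \<in> {a..b}" "t \<le> t0" "p n < t" for t
  proof -
    have "variation_sum \<gamma> n p \<le> len (p n)"
      using variation_sum_le_curve_length [OF q(1), of \<gamma>] curve_length_len [of "p n"] q assms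
      by auto
    moreover have "dist (\<gamma> (p n)) (\<gamma> t) \<le> len t - len (p n)"
      using dist_le_len_diff [of "p n" t] q t by auto
    moreover have "len t0 < variation_sum \<gamma> n p + dist (\<gamma> (p n)) (\<gamma> t0) + e"
      using p(2) curve_length_len [of t0] assms q(4) by auto
    ultimately show ?thesis
      using dist_triangle [of "\<gamma> (p n)" "\<gamma> t0" "\<gamma> t"] by (simp add: dist_commute)
  qed
  then show ?thesis using q by (intro exI [of _ "t0 - p n"]) auto
qed

text \<open>Near \<open>t0\<close> an increment of \<open>len\<close> exceeds the chord by at most
  \<open>e / 2\<close>, and the chord is below \<open>e / 2\<close> by continuity of
  \<open>\<gamma>\<close>.\<close>

lemma continuous_on_len: "continuous_on {a..b} len"
  unfolding continuous_on_iff
proof (intro ballI allI impI)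
  fix t0 e :: real assume t0: "t0 \<in> {a..b}" and e: "0 < e"
  obtain d1 where d1: "d1 > 0"
      "\<And>t. t \<in> {a..b} \<Longrightarrow> t0 \<le> t \<Longrightarrow> t < t0 + d1 \<Longrightarrow> len t - len t0 \<le> dist (\<gamma> t0) (\<gamma> t) + e / 2"
    using len_right_close [OF t0, of "e / 2"] e by auto
  obtain d2 where d2: "d2 > 0"
      "\<And>t. t \<in> {a..b} \<Longrightarrow> t \<le> t0 \<Longrightarrow> t0 < t + d2 \<Longrightarrow> len t0 - len t \<le> dist (\<gamma> t0) (\<gamma> t) + e / 2"
    using len_left_close [OF t0, of "e / 2"] e by auto
  obtain d3 where d3: "d3 > 0"
      "\<And>t. t \<in> {a..b} \<Longrightarrow> dist t t0 < d3 \<Longrightarrow> dist (\<gamma> t) (\<gamma> t0) < e / 2"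
    using cont t0 e unfolding continuous_on_iff by (metis half_gt_zero)
  show "\<exists>d>0. \<forall>t\<in>{a..b}. dist t t0 < d \<longrightarrow> dist (len t) (len t0) < e"
  proof (intro exI [of _ "min d1 (min d2 d3)"] conjI ballI impI)
    fix t assume t: "t \<in> {a..b}" "dist t t0 < min d1 (min d2 d3)"
    show "dist (len t) (len t0) < e"
      using d1(2) [OF t(1)] d2(2) [OF t(1)] d3(2) [OF t(1)] t t0 len_mono [of t t0] len_mono [of t0 t]
      by (cases t t0 rule: le_cases) (auto simp: dist_real_def dist_commute)
  qed (use d1 d2 d3 in auto)
qed

text \<open>The intermediate value theorem for \<open>len\<close> shows that every \<open>s\<close>
  is attained; \<open>arclength_param_curve_length\<close> makes the value independent of the choice
  in \<open>SOME\<close>.\<close>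

lemma arclength_param_witness:
  assumes "s \<in> {0..real_of_ereal (curve_length a b \<gamma>)}"
  obtains t where "t \<in> {a..b}" "len t = s" "arclength_param a b \<gamma> s = \<gamma> t"
proof -
  have "len a = 0" by (simp add: len_def)
  then obtain t where t: "a \<le> t" "t \<le> b" "len t = s"
    using IVT' [of len a s b] assms ab continuous_on_len by (auto simp: len_def)
  moreover have "arclength_param a b \<gamma> s = \<gamma> t"
    using arclength_param_curve_length [of t a b \<gamma> s] curve_length_len [of t] t by auto
  ultimately show ?thesis using that by auto
qed

lemma arclength_param_lipschitz:
  assumes "s \<in> {0..real_of_ereal (curve_length a b \<gamma>)}" "s' \<in> {0..real_of_ereal (curve_length a b \<gamma>)}"
  shows "dist (arclength_param a b \<gamma> s) (arclength_param a b \<gamma> s') \<le> dist s s'"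
proof -
  obtain t where t: "t \<in> {a..b}" "len t = s" "arclength_param a b \<gamma> s = \<gamma> t"
    using arclength_param_witness [OF assms(1)] .
  obtain t' where t': "t' \<in> {a..b}" "len t' = s'" "arclength_param a b \<gamma> s' = \<gamma> t'"
    using arclength_param_witness [OF assms(2)] .
  show ?thesis
    using t t' dist_le_len_diff [of t t'] dist_le_len_diff [of t' t]
    by (cases t t' rule: le_cases) (auto simp: dist_real_def dist_commute)
qed

lemma arclength_param_ends:
  "arclength_param a b \<gamma> 0 = \<gamma> a"
  "arclength_param a b \<gamma> (real_of_ereal (curve_length a b \<gamma>)) = \<gamma> b"
  using ab curve_length_sub_finite [of a b]
  by (auto intro!: arclength_param_curve_length simp: zero_ereal_def)

lemma continuous_on_arclength_param:
  "continuous_on {0..real_of_ereal (curve_length a b \<gamma>)} (arclength_param a b \<gamma>)"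
  unfolding continuous_on_iff using arclength_param_lipschitz by (meson le_less_trans)

end

section \<open>Integrating a pointwise Lipschitz bound\<close>

text \<open>With a slack \<open>e * (t - s)\<close> the estimate passes to adjoining intervals and
  holds on all short intervals around a given point, so Bolzano's bisection principle extends it to
  \<open>{0..l}\<close>. Then the slack tends to zero.\<close>

lemma dist_le_integral:
  fixes h :: "real \<Rightarrow> 'b::metric_space" and u :: "real \<Rightarrow> real"
  assumes l: "0 \<le> l" and u: "continuous_on {0..l} u"
    and h: "\<And>s e. s \<in> {0..l} \<Longrightarrow> 0 < e \<Longrightarrow>
      \<exists>d>0. \<forall>s'\<in>{0..l}. dist s s' < d \<longrightarrow> dist (h s) (h s') \<le> (u s + e) * dist s s'"
  shows "dist (h 0) (h l) \<le> integral {0..l} u"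
proof -
  have int: "u integrable_on {s..t}" if "0 \<le> s" "t \<le> l" for s t
    using u that by (intro integrable_continuous_real) (auto intro: continuous_on_subset)
  have "dist (h 0) (h l) \<le> integral {0..l} u + e * l" if e: "0 < e" for e
  proof -
    let ?P = "\<lambda>s t. 0 \<le> s \<and> t \<le> l \<longrightarrow> dist (h s) (h t) \<le> integral {s..t} u + e * (t - s)"
    have "?P 0 l"
    proof (rule Bolzano [where P = ?P, OF l])
      fix r s t assume *: "?P r s" "?P s t" "r \<le> s" "s \<le> t"
      show "?P r t"
      proof
        assume rt: "0 \<le> r \<and> t \<le> l"
        have "integral {r..s} u + integral {s..t} u = integral {r..t} u"
          using * rt by (intro Henstock_Kurzweil_Integration.integral_combine int) auto
        then show "dist (h r) (h t) \<le> integral {r..t} u + e * (t - r)"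
          using * rt dist_triangle [of "h r" "h t" "h s"] by (auto simp: algebra_simps)
      qed
    next
      fix x assume x: "0 \<le> x" "x \<le> l"
      \<comment> \<open>Half of the slack pays for the local Lipschitz constant
        \<open>u x + k\<close>, half for the oscillation of \<open>u\<close>, which stays above
        \<open>u x - k\<close>; the two differ by \<open>2 * k = e\<close>.\<close>
      define k where "k = e / 2"
      have k: "0 < k" "e = 2 * k" using e by (simp_all add: k_def)
      obtain d1 where d1: "d1 > 0"
          "\<And>s. s \<in> {0..l} \<Longrightarrow> dist x s < d1 \<Longrightarrow> dist (h x) (h s) \<le> (u x + k) * dist x s"
        using h [of x k] x k by auto
      obtain d2 where d2: "d2 > 0" "\<And>s. s \<in> {0..l} \<Longrightarrow> dist s x < d2 \<Longrightarrow> dist (u s) (u x) < k"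
        using u x k(1) unfolding continuous_on_iff by (metis atLeastAtMost_iff)
      show "\<exists>d>0. \<forall>s t. s \<le> x \<and> x \<le> t \<and> t - s < d \<longrightarrow> ?P s t"
      proof (intro exI [of _ "min d1 d2"] conjI allI impI)
        fix s t assume *: "s \<le> x \<and> x \<le> t \<and> t - s < min d1 d2" "0 \<le> s \<and> t \<le> l"
        have "integral {s..t} (\<lambda>_. u x - k) \<le> integral {s..t} u"
        proof (rule integral_le)
          fix r assume r: "r \<in> {s..t}"
          then have "\<bar>r - x\<bar> < d2" using * by (simp add: abs_less_iff)
          then have "\<bar>u r - u x\<bar> < k"
            using d2(2) [of r] r * unfolding dist_real_def by auto
          then show "u x - k \<le> u r" by linarith
        qed (use int * in auto)
        then have "(u x - k) * (t - s) \<le> integral {s..t} u"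
          using * by (simp add: mult.commute)
        \<comment> \<open>The hypothesis at \<open>x\<close> compares \<open>h\<close> only with
          \<open>h x\<close>, so the distance is split there.\<close>
        moreover have "dist (h s) (h t) \<le> dist (h x) (h s) + dist (h x) (h t)"
          by (rule dist_triangle3)
        moreover have "dist (h x) (h s) \<le> (u x + k) * (x - s)"
          using d1(2) [of s] * by (auto simp: dist_real_def)
        moreover have "dist (h x) (h t) \<le> (u x + k) * (t - x)"
          using d1(2) [of t] * by (auto simp: dist_real_def)
        ultimately show "dist (h s) (h t) \<le> integral {s..t} u + e * (t - s)"
          by (simp add: k(2) algebra_simps)
      qed (use d1 d2 in auto)
    qed
    then show ?thesis by simp
  qed
  note * = this
  show ?thesis
  proof (rule field_le_epsilon)
    fix e :: real assume "0 < e"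
    \<comment> \<open>The denominator \<open>l + 1\<close> also covers \<open>l = 0\<close>.\<close>
    have "e / (l + 1) * l \<le> e" using \<open>0 < e\<close> l by (simp add: field_simps)
    then show "dist (h 0) (h l) \<le> integral {0..l} u + e"
      using * [of "e / (l + 1)"] \<open>0 < e\<close> l by force
  qed
qed

text \<open>At a limit point the margin \<open>e\<close> makes the bound on the upper limit strict,
  hence valid for all nearby quotients. At an isolated point a small ball contains only
  \<open>x\<close>.\<close>

lemma dstar_boundD:
  assumes "dstar f x \<le> ereal c" "0 \<le> c" "0 < e"
  shows "\<exists>d>0. \<forall>y. dist x y < d \<longrightarrow> dist (f x) (f y) \<le> (c + e) * dist x y"
proof (cases "x islimpt UNIV")
  case True
  then have "Limsup (at x) (\<lambda>y. ereal (dist (f x) (f y) / dist x y)) < ereal (c + e)"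
    using assms by (simp add: dstar_def order_le_less_trans)
  then have "\<forall>\<^sub>F y in at x. dist (f x) (f y) / dist x y < c + e"
    by (auto dest!: Limsup_lessD)
  then obtain d where d: "d > 0"
      "\<And>y. y \<noteq> x \<Longrightarrow> dist y x < d \<Longrightarrow> dist (f x) (f y) / dist x y < c + e"
    unfolding eventually_at by auto
  have "dist (f x) (f y) \<le> (c + e) * dist x y" if "dist x y < d" for y
    using d(2) [of y] that by (cases "y = x") (auto simp: dist_commute field_simps)
  then show ?thesis using d(1) by blast
next
  case False
  then obtain d where "d > 0" "\<And>y. dist y x < d \<Longrightarrow> y = x"
    by (auto simp: islimpt_approachable)
  then have "y = x" if "dist x y < d" for y using that by (simp add: dist_commute)
  then show ?thesis using \<open>d > 0\<close> by (metis dist_self mult_zero_right order_refl)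
qed

text \<open>Apply \<open>dist_le_integral\<close> to \<open>f\<close> along the arc length
  parametrization \<open>\<sigma>\<close>. As \<open>\<sigma>\<close> is 1-Lipschitz and the local
  constant of \<open>f\<close> is non-negative, distances in the space may be replaced by distances
  of parameters.\<close>

lemma dist_le_curve_integral:
  assumes curve: "(a, b, \<gamma>) \<in> rectifiable_curves x y"
    and v: "continuous_on UNIV v" "\<And>z. 0 \<le> v z" and L: "0 \<le> L"
    and f: "\<And>z. dstar f z \<le> ereal (L * v z)"
  shows "dist (f x) (f y) \<le> L * curve_integral a b \<gamma> v"
proof -
  have c: "a \<le> b" "continuous_on {a..b} \<gamma>" "curve_length a b \<gamma> < \<infinity>" and xy: "\<gamma> a = x" "\<gamma> b = y"
    using curve by (auto simp: rectifiable_curves_def)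
  define l where "l = real_of_ereal (curve_length a b \<gamma>)"
  define \<sigma> where "\<sigma> = arclength_param a b \<gamma>"
  have \<sigma>: "continuous_on {0..l} \<sigma>"
    using continuous_on_arclength_param [OF c] by (simp add: \<sigma>_def l_def)
  have lip: "dist (\<sigma> s) (\<sigma> s') \<le> dist s s'" if "s \<in> {0..l}" "s' \<in> {0..l}" for s s'
    using arclength_param_lipschitz [OF c] that by (simp add: \<sigma>_def l_def)
  have "dist (f (\<sigma> 0)) (f (\<sigma> l)) \<le> integral {0..l} (\<lambda>s. L * v (\<sigma> s))"
  proof (rule dist_le_integral)
    show "0 \<le> l"
      using curve_length_nonneg [OF c(1), of \<gamma>] by (simp add: l_def real_of_ereal_pos)
    show "continuous_on {0..l} (\<lambda>s. L * v (\<sigma> s))"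
      by (intro continuous_intros continuous_on_compose2 [OF v(1)] \<sigma>) auto
    fix s e :: real assume s: "s \<in> {0..l}" and e: "0 < e"
    have nonneg: "0 \<le> L * v (\<sigma> s)" using v L by simp
    obtain d where d: "d > 0"
        "\<And>z. dist (\<sigma> s) z < d \<Longrightarrow> dist (f (\<sigma> s)) (f z) \<le> (L * v (\<sigma> s) + e) * dist (\<sigma> s) z"
      using dstar_boundD [OF f nonneg e] by blast
    have "dist (f (\<sigma> s)) (f (\<sigma> s')) \<le> (L * v (\<sigma> s) + e) * dist s s'"
      if "s' \<in> {0..l}" "dist s s' < d" for s'
    proof -
      have "dist (f (\<sigma> s)) (f (\<sigma> s')) \<le> (L * v (\<sigma> s) + e) * dist (\<sigma> s) (\<sigma> s')"
        using d(2) lip [OF s] that by (meson le_less_trans)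
      also have "\<dots> \<le> (L * v (\<sigma> s) + e) * dist s s'"
        using lip [OF s that(1)] nonneg e by (intro mult_left_mono) auto
      finally show ?thesis .
    qed
    then show "\<exists>d>0. \<forall>s'\<in>{0..l}. dist s s' < d \<longrightarrow>
        dist (f (\<sigma> s)) (f (\<sigma> s')) \<le> (L * v (\<sigma> s) + e) * dist s s'"
      using d(1) by blast
  qed
  then show ?thesis
    using arclength_param_ends [OF c] xy by (simp add: curve_integral_def \<sigma>_def l_def)
qed

text \<open>If the integrand is not integrable, \<open>integral\<close> has the default value
  0.\<close>

lemma curve_integral_nonneg: "(\<And>z. 0 \<le> v z) \<Longrightarrow> 0 \<le> curve_integral a b \<gamma> v"
  unfolding curve_integral_def by (cases "(\<lambda>s. v (arclength_param a b \<gamma> s)) integrable_on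
    {0..real_of_ereal (curve_length a b \<gamma>)}")
    (auto intro: Henstock_Kurzweil_Integration.integral_nonneg simp: not_integrable_integral)

lemma weighted_dist_nonneg:
  fixes x y :: "'a::metric_space"
  assumes "rectifiably_connected TYPE('a)" "\<And>z. 0 \<le> v z"
  shows "0 \<le> weighted_dist v x y"
  unfolding weighted_dist_def
proof (rule cINF_greatest)
  show "rectifiable_curves x y \<noteq> {}" using assms by (simp add: rectifiably_connected_def)
qed (auto intro: curve_integral_nonneg assms)

lemma dist_le_weighted_dist:
  fixes f :: "'a::metric_space \<Rightarrow> 'b::metric_space"
  assumes X: "rectifiably_connected TYPE('a)"
    and v: "continuous_on UNIV v" "\<And>z. 0 \<le> v z" and L: "0 \<le> L"
    and f: "\<And>z. dstar f z \<le> ereal (L * v z)"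
  shows "dist (f x) (f y) \<le> L * weighted_dist v x y"
proof -
  have ne: "rectifiable_curves x y \<noteq> {}" using X by (simp add: rectifiably_connected_def)
  show ?thesis
  \<comment> \<open>For positive \<open>L\<close> the estimate is divided by \<open>L\<close> before
    taking the infimum; for \<open>L = 0\<close> a single curve suffices.\<close>
  proof (cases "L = 0")
    case True
    obtain a b \<gamma> where "(a, b, \<gamma>) \<in> rectifiable_curves x y" using ne by auto
    from dist_le_curve_integral [OF this v L f] True show ?thesis by simp
  next
    case False
    have "dist (f x) (f y) / L \<le> weighted_dist v x y"
      unfolding weighted_dist_def
    proof (rule cINF_greatest [OF ne], clarify)
      fix a b \<gamma> assume "(a, b, \<gamma>) \<in> rectifiable_curves x y"
      from dist_le_curve_integral [OF this v L f] False L
      show "dist (f x) (f y) / L \<le> curve_integral a b \<gamma> v" by (simp add: field_simps)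
    qed
    then show ?thesis using False L by (simp add: field_simps)
  qed
qed

section \<open>Hoelder classes\<close>

lemma holder_norm_le: "C \<in> holder_consts \<alpha> f \<Longrightarrow> holder_norm \<alpha> f \<le> C"
  unfolding holder_norm_def by (rule cInf_lower) (auto simp: holder_consts_def intro!: bdd_belowI)

text \<open>The infimum is attained: for each pair of distinct points, every admissible constant is
  at least the Hoelder quotient, hence so is the infimum.\<close>

lemma local_holder_norm_mem:
  assumes "f \<in> local_holder_class \<alpha> w"
  shows "local_holder_norm \<alpha> w f \<in> local_holder_consts \<alpha> w f"
proof -
  have ne: "local_holder_consts \<alpha> w f \<noteq> {}" using assms by (simp add: local_holder_class_def)
  have "dist (f x) (f y) \<le> local_holder_norm \<alpha> w f * dist x y powr \<alpha>" if "y \<in> ball x (w x)" for x y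
  proof (cases "x = y")
    case False
    have "dist (f x) (f y) / dist x y powr \<alpha> \<le> local_holder_norm \<alpha> w f"
      unfolding local_holder_norm_def
      by (rule cInf_greatest [OF ne])
        (use that False in \<open>auto simp: local_holder_consts_def field_simps\<close>)
    then show ?thesis using False by (simp add: field_simps)
  qed simp
  moreover have "0 \<le> local_holder_norm \<alpha> w f"
    unfolding local_holder_norm_def
    by (rule cInf_greatest [OF ne]) (auto simp: local_holder_consts_def)
  ultimately show ?thesis by (simp add: local_holder_consts_def)
qed

lemma local_holder_norm_const:
  assumes "\<And>x y. f x = f y"
  shows "local_holder_norm \<alpha> w f = 0"
proof -
  have "dist (f x) (f y) = 0" for x y using assms [of x y] by simp
  then have 0: "0 \<in> local_holder_consts \<alpha> w f" by (simp add: local_holder_consts_def)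
  show ?thesis
    unfolding local_holder_norm_def by (rule cInf_eq_minimum [OF 0]) (simp add: local_holder_consts_def)
qed

section \<open>From the regularity condition to the global Hoelder estimate\<close>

lemma p_regular_dstar_le:
  assumes w: "0 < w x" and p: "1 \<le> p" and f: "p_regular p w A K f" and K: "0 \<le> K"
    and \<alpha>: "0 < \<alpha>" and C: "C \<in> local_holder_consts \<alpha> w (\<lambda>z. infdist (f z) A powr p)"
  shows "dstar f x \<le> ereal (K * C powr (1 / p) * w x powr (\<alpha> / p - 1))"
proof -
  have C0: "0 \<le> C" using C by (simp add: local_holder_consts_def)
  have bound: "dstar f x \<le> ereal (K * C powr (1 / p) * r powr (\<alpha> / p - 1))"
    if r: "0 < r" "r < w x" for r
  proof -
    let ?g = "\<lambda>z. infdist (f z) A powr p"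
    have "(SUP y\<in>ball x r. ereal (\<bar>?g x - ?g y\<bar> powr (1 / p))) \<le> ereal (C powr (1 / p) * r powr (\<alpha> / p))"
    proof (rule SUP_least)
      fix y assume y: "y \<in> ball x r"
      have "\<bar>?g x - ?g y\<bar> \<le> C * dist x y powr \<alpha>"
        using C y r by (simp add: local_holder_consts_def dist_real_def)
      also have "\<dots> \<le> C * r powr \<alpha>"
        using y C0 \<alpha> by (intro mult_left_mono powr_mono2) auto
      finally have "\<bar>?g x - ?g y\<bar> powr (1 / p) \<le> (C * r powr \<alpha>) powr (1 / p)"
        using p by (intro powr_mono2) auto
      also have "\<dots> = C powr (1 / p) * r powr (\<alpha> / p)"
        using C0 by (simp add: powr_mult powr_powr)
      finally show "ereal (\<bar>?g x - ?g y\<bar> powr (1 / p)) \<le> ereal (C powr (1 / p) * r powr (\<alpha> / p))"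
        by simp
    qed
    \<comment> \<open>Here \<open>0 \<le> K\<close> is used; the factor \<open>1 / r\<close> then
      lowers the exponent of \<open>r\<close> to \<open>\<alpha> / p - 1\<close>.\<close>
    then have "ereal (K / r) * (SUP y\<in>ball x r. ereal (\<bar>?g x - ?g y\<bar> powr (1 / p)))
        \<le> ereal (K / r) * ereal (C powr (1 / p) * r powr (\<alpha> / p))"
      using K r by (intro ereal_mult_left_mono) auto
    also have "\<dots> = ereal (K * C powr (1 / p) * r powr (\<alpha> / p - 1))"
      using r by (simp add: powr_diff)
    finally show ?thesis
      using f r unfolding p_regular_def by (meson order_trans)
  qed
  \<comment> \<open>Regularity speaks only of radii below \<open>w x\<close>, so the value at
    \<open>w x\<close> is reached as a left limit.\<close>
  have "((\<lambda>r. ereal (K * C powr (1 / p) * r powr (\<alpha> / p - 1))) \<longlongrightarrow>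
      ereal (K * C powr (1 / p) * w x powr (\<alpha> / p - 1))) (at_left (w x))"
    using w by (intro tendsto_intros) auto
  moreover have "\<forall>\<^sub>F r in at_left (w x). dstar f x \<le> ereal (K * C powr (1 / p) * r powr (\<alpha> / p - 1))"
    using eventually_at_left_real [OF w] by eventually_elim (auto intro: bound)
  ultimately show ?thesis by (intro tendsto_lowerbound) auto
qed

text \<open>The supremum is non-negative because \<open>y = x\<close> contributes 0, so a negative
  \<open>K\<close> makes the right-hand side non-positive. This serves to rule out
  \<open>K < 0\<close> for non-constant \<open>f\<close>.\<close>

lemma p_regular_neg_dstar_le:
  assumes "0 < w x" "p_regular p w A K f" "K < 0"
  shows "dstar f x \<le> 0"
proof -
  let ?h = "\<lambda>y. ereal (\<bar>infdist (f x) A powr p - infdist (f y) A powr p\<bar> powr (1 / p))"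
  obtain r where r: "0 < r" "r < w x" using assms(1) dense by blast
  have "0 \<le> ?h x" by simp
  also have "?h x \<le> (SUP y\<in>ball x r. ?h y)"
    using r by (intro SUP_upper) auto
  finally have "ereal (K / r) * (SUP y\<in>ball x r. ?h y) \<le> 0"
    using assms r by (auto simp: ereal_mult_le_0_iff divide_le_0_iff)
  moreover have "dstar f x \<le> ereal (K / r) * (SUP y\<in>ball x r. ?h y)"
    using assms(2) r by (simp add: p_regular_def)
  ultimately show ?thesis by (rule order_trans [rotated])
qed

theorem theorem3p8:
  fixes f :: "'a::metric_space \<Rightarrow> 'b::metric_space"
    and w :: "'a \<Rightarrow> real"
    and A :: "'b set"
    and p K \<alpha> \<beta> M :: real
    and g :: "'a \<Rightarrow> real"
  assumes "rectifiably_connected TYPE('a)"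
    and "weight w"
    and "1 \<le> p"
    and "A \<noteq> {}"
    and "p_regular p w A K f"
    and "0 < \<alpha>"
    and "\<beta> = \<alpha> / p"
    and "\<And>x y. weighted_dist (\<lambda>z. w z powr (\<beta> - 1)) x y \<le> M * dist x y powr \<beta>"
    and "\<And>z. g z = infdist (f z) A powr p"
    and "g \<in> local_holder_class \<alpha> w"
  shows "f \<in> holder_class (\<alpha> / p) \<and>
         holder_norm (\<alpha> / p) f \<le> M * K * local_holder_norm \<alpha> w g powr (1 / p)"
proof -
  define C where "C = local_holder_norm \<alpha> w g"
  define v where "v = (\<lambda>z. w z powr (\<beta> - 1))"
  have g: "g = (\<lambda>z. infdist (f z) A powr p)" using assms(9) by auto
  have w: "0 < w z" for z using assms(2) by (simp add: weight_def)
  have C: "C \<in> local_holder_consts \<alpha> w g"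
    unfolding C_def using assms(10) by (rule local_holder_norm_mem)
  have v: "continuous_on UNIV v" "\<And>z. 0 \<le> v z"
    using assms(2) w unfolding v_def weight_def
    by (auto intro!: continuous_intros simp: less_imp_neq [symmetric])
  \<comment> \<open>This membership gives both claims: the set of constants is non-empty, and its
    infimum is at most this element.\<close>
  have "M * K * C powr (1 / p) \<in> holder_consts (\<alpha> / p) f"
  proof (cases "\<forall>x y. f x = f y")
    \<comment> \<open>Here \<open>M\<close> or \<open>K\<close> may be negative, but \<open>C = 0\<close>.\<close>
    case True
    then have "g x = g y" for x y unfolding g by metis
    then have "C = 0" unfolding C_def by (rule local_holder_norm_const)
    with True show ?thesis by (simp add: holder_consts_def)
  next
    case False
    then obtain x0 y0 where f0: "f x0 \<noteq> f y0" by auto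
    \<comment> \<open>Two points with different images fix the sign of \<open>M\<close>: the
      weighted distance between them is non-negative, while their distance is positive.\<close>
    then have "0 < dist x0 y0 powr \<beta>" by auto
    moreover have "0 \<le> M * dist x0 y0 powr \<beta>"
      using weighted_dist_nonneg [where v = v, OF assms(1) v(2), of x0 y0] assms(8) [of x0 y0]
      by (simp add: v_def)
    ultimately have M: "0 \<le> M" by (simp add: zero_le_mult_iff)
    have K: "0 \<le> K"
    proof (rule ccontr)
      assume "\<not> 0 \<le> K"
      \<comment> \<open>Integrating this bound with \<open>L = 0\<close> would make \<open>f\<close>
        constant.\<close>
      then have "dstar f z \<le> ereal (0 * v z)" for z
        using p_regular_neg_dstar_le [of w z p A K f] w assms(5) by (simp flip: zero_ereal_def)
      from dist_le_weighted_dist [OF assms(1) v order_refl this, of x0 y0] f0 show False by simp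
    qed
    define L where "L = K * C powr (1 / p)"
    have L: "0 \<le> L" using K by (simp add: L_def)
    have "dstar f z \<le> ereal (L * v z)" for z
      using p_regular_dstar_le [OF w assms(3) assms(5) K assms(6)] C assms(7)
      by (simp add: L_def v_def g)
    note est = dist_le_weighted_dist [OF assms(1) v L this]
    have "dist (f x) (f y) \<le> L * (M * dist x y powr \<beta>)" for x y
      using est assms(8) [of x y] L unfolding v_def by (meson mult_left_mono order_trans)
    then show ?thesis
      using K M assms(7) by (simp add: holder_consts_def L_def mult_ac)
  qed
  then show ?thesis
    unfolding C_def using holder_norm_le by (auto simp: holder_class_def)
qed

end
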